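(* Let $T,\Lambda>0$ and consider the Hill equation $\ddot x+q(t,\lambda)x=0$, where $q\in C^{3}(\mathbb{R}\times[0,\Lambda])$ is $T$-periodic in $t$. Let $\Delta(\lambda)$, $\lambda\in[0,\Lambda]$, be its discriminant function and suppose that $$\Delta(0)=2,\qquad \Delta'(0)=0,\qquad \Delta''(0)\neq 0.$$ Let $\mathcal K$ be a positive constant with $\mathcal K\ge\sup_{\lambda\in[0,\Lambda]}|\Delta'''(\lambda)|$ and define $$p(\lambda)=\mathcal K\lambda^{3}-3\Delta''(0)\lambda^{2}-24,\qquad \mu=\frac{3|\Delta''(0)|}{\mathcal K}.$$ i) If $\Delta''(0)>0$, then $\Delta(\lambda)>2$ for all $\lambda\in I_1=\,]0,\min\{\mu,\Lambda\}[$. ii) If $\Delta''(0)<0$ and $p(\Lambda)>0$ (respectively $p(\Lambda)\le 0$), then $|\Delta(\lambda)|<2$ for all $\lambda\in I_2=\,]0,\min\{\mu,\mu_0,\Lambda\}[$ (respectively for all $\lambda\in I_1$), where $\mu_0$ is the unique positive root of $p(\lambda)=0$.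
   Context: The discriminant function $\Delta(\lambda)$ of $\ddot x+q(t,\lambda)x=0$ with $q$ $T$-periodic in $t$ is the trace of a monodromy matrix (over the period $T$) of the associated first order planar system; equivalently $\Delta(\lambda)=\phi_1(T,\lambda)+\dot\phi_2(T,\lambda)$, where $\phi_1,\phi_2$ are the solutions with $\phi_1(0,\lambda)=\dot\phi_2(0,\lambda)=1$, $\dot\phi_1(0,\lambda)=\phi_2(0,\lambda)=0$. Primes denote derivatives with respect to $\lambda$. $]a,b[$ denotes an open interval. *)

theory Defs
  imports "HOL-Analysis.Analysis"
begin

text \<open>
  \<open>C_k_on k S f\<close> says that \<open>f\<close> is of class \<open>C\<close>-\<open>k\<close> on \<open>S\<close>, with derivatives taken relative to \<open>S\<close>.
  It is meant for sets such as closed strips \<open>UNIV \<times> {0..b}\<close>, \<open>b > 0\<close>, where a derivative relative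
  to \<open>S\<close> is unique (one-sided in the second variable on the boundary), so that \<open>f1\<close> and \<open>f2\<close> are
  determined on \<open>S\<close> as the two partial derivatives of \<open>f\<close>. Continuity of \<open>f\<close> itself is implied.
\<close>

primrec C_k_on :: "nat \<Rightarrow> (real \<times> real) set \<Rightarrow> (real \<times> real \<Rightarrow> real) \<Rightarrow> bool" where
  "C_k_on 0 S f \<longleftrightarrow> continuous_on S f"
| "C_k_on (Suc k) S f \<longleftrightarrow>
     (\<exists>f1 f2. C_k_on k S f1 \<and> C_k_on k S f2 \<and>
        (\<forall>p\<in>S. (f has_derivative (\<lambda>v. f1 p * fst v + f2 p * snd v)) (at p within S)))"

text \<open>Iterated derivative relative to \<open>S\<close>; one-sided at the end points if \<open>S\<close> is a compact interval.\<close>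

primrec nth_deriv_on :: "nat \<Rightarrow> real set \<Rightarrow> (real \<Rightarrow> real) \<Rightarrow> real \<Rightarrow> real" where
  "nth_deriv_on 0 S f = f"
| "nth_deriv_on (Suc n) S f = (\<lambda>x. vector_derivative (nth_deriv_on n S f) (at x within S))"

definition hill_solution :: "(real \<Rightarrow> real) \<Rightarrow> (real \<Rightarrow> real) \<Rightarrow> bool" where
  "hill_solution Q x \<longleftrightarrow>
     (\<forall>t. x differentiable (at t) \<and> deriv x differentiable (at t) \<and>
          deriv (deriv x) t + Q t * x t = 0)"

text \<open>
  \<open>is_discriminant T Q d\<close>: \<open>d\<close> is the discriminant over the period \<open>T\<close> of the equation with
  coefficient \<open>Q\<close>. For continuous \<open>Q\<close> the solutions \<open>x1\<close> and \<open>x2\<close> exist and are unique, so there is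
  exactly one such \<open>d\<close>.
\<close>

definition is_discriminant :: "real \<Rightarrow> (real \<Rightarrow> real) \<Rightarrow> real \<Rightarrow> bool" where
  "is_discriminant T Q d \<longleftrightarrow>
     (\<exists>x1 x2. hill_solution Q x1 \<and> x1 0 = 1 \<and> deriv x1 0 = 0 \<and>
              hill_solution Q x2 \<and> x2 0 = 0 \<and> deriv x2 0 = 1 \<and>
              d = x1 T + deriv x2 T)"

end

theory Submission imports Defs begin

text \<open>
  The analytic content is that \<open>\<Delta>\<close> is of class \<open>C\<^sup>3\<close> on the closed interval. Comparing a solution at
  parameter \<open>m\<close> with the one at \<open>l\<close> by variation of constants expresses their difference through
  \<open>\<integral> (q(s,l) - q(s,m)) u(s,m) \<phi>\<^sub>i(s,l) ds\<close>. With the energy bound this gives Lipschitz dependence on the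
  parameter and then a formula for the parameter derivative of \<open>\<phi>\<^sub>1\<close>, \<open>\<phi>\<^sub>2\<close> and of their velocities in
  terms of these same functions and \<open>\<partial>q/\<partial>\<lambda>\<close>. Hence each derivative of \<open>q\<close> yields
  one more derivative of the solutions. The theorem itself follows from
  \<open>\<bar>\<Delta>(\<lambda>) - 2 - \<Delta>''(0) \<lambda>\<^sup>2/2\<bar> \<le> K \<lambda>\<^sup>3/6\<close>: the upper bound on \<open>\<lambda>\<close> by \<open>\<mu>\<close> fixes the sign of \<open>\<Delta> - 2\<close>,
  and \<open>\<Delta>(\<lambda>) \<ge> -2 - p(\<lambda>)/6\<close>, where \<open>p\<close> increases on the positive axis.
\<close>

section \<open>Functions of time and parameter: differentiability in the parameter\<close>

text \<open>
  The parameter is the second argument. In \<open>t\<close>, \<open>param_smooth\<close> demands nothing but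
  joint continuity, which is why it is preserved by \<open>t \<mapsto> \<integral>\<^sub>0\<^sup>t\<close>.
\<close>

definition has_param_deriv ::
    "real \<Rightarrow> real \<Rightarrow> (real \<Rightarrow> real \<Rightarrow> real) \<Rightarrow> (real \<Rightarrow> real \<Rightarrow> real) \<Rightarrow> bool" where
  "has_param_deriv T L f g \<longleftrightarrow>
     (\<forall>t\<in>{0..T}. \<forall>l\<in>{0..L}. ((\<lambda>l. f t l) has_real_derivative g t l) (at l within {0..L}))"

primrec param_smooth :: "nat \<Rightarrow> real \<Rightarrow> real \<Rightarrow> (real \<Rightarrow> real \<Rightarrow> real) \<Rightarrow> bool" where
  "param_smooth 0 T L f \<longleftrightarrow> continuous_on ({0..T} \<times> {0..L}) (\<lambda>(t, l). f t l)"
| "param_smooth (Suc k) T L f \<longleftrightarrow> continuous_on ({0..T} \<times> {0..L}) (\<lambda>(t, l). f t l) \<and>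
     (\<exists>g. param_smooth k T L g \<and> has_param_deriv T L f g)"

lemma has_param_derivD:
  "has_param_deriv T L f g \<Longrightarrow> t \<in> {0..T} \<Longrightarrow> l \<in> {0..L} \<Longrightarrow>
     ((\<lambda>l. f t l) has_real_derivative g t l) (at l within {0..L})"
  by (simp add: has_param_deriv_def)

lemma has_param_deriv_add:
  "has_param_deriv T L f f' \<Longrightarrow> has_param_deriv T L g g' \<Longrightarrow>
     has_param_deriv T L (\<lambda>t l. f t l + g t l) (\<lambda>t l. f' t l + g' t l)"
  unfolding has_param_deriv_def by (auto intro!: derivative_eq_intros)

lemma has_param_deriv_mult:
  "has_param_deriv T L f f' \<Longrightarrow> has_param_deriv T L g g' \<Longrightarrow>
     has_param_deriv T L (\<lambda>t l. f t l * g t l) (\<lambda>t l. f' t l * g t l + f t l * g' t l)"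
  unfolding has_param_deriv_def by (auto intro!: derivative_eq_intros)

lemma param_smooth_continuous:
  "param_smooth k T L f \<Longrightarrow> continuous_on ({0..T} \<times> {0..L}) (\<lambda>(t, l). f t l)"
  by (cases k) auto

lemma param_smooth_SucI:
  "continuous_on ({0..T} \<times> {0..L}) (\<lambda>(t, l). f t l) \<Longrightarrow> param_smooth k T L g \<Longrightarrow>
     has_param_deriv T L f g \<Longrightarrow> param_smooth (Suc k) T L f"
  by auto

lemma param_smooth_Suc_imp: "param_smooth (Suc k) T L f \<Longrightarrow> param_smooth k T L f"
proof (induction k arbitrary: f)
  case (Suc k)
  then obtain g where "param_smooth (Suc k) T L g" "has_param_deriv T L f g"
    unfolding param_smooth.simps(2)[of "Suc k"] by blast
  then show ?case
    by (intro param_smooth_SucI[OF param_smooth_continuous[OF Suc.prems]] Suc.IH)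
qed simp

lemma continuous_on_param_add_mult:
  assumes "continuous_on S (\<lambda>(t, l). f t l :: real)" and "continuous_on S (\<lambda>(t, l). g t l)"
  shows "continuous_on S (\<lambda>(t, l). f t l + g t l)" and "continuous_on S (\<lambda>(t, l). f t l * g t l)"
  using assms by (auto simp: split_beta intro!: continuous_intros)

lemma param_smooth_add:
  "param_smooth k T L f \<Longrightarrow> param_smooth k T L g \<Longrightarrow> param_smooth k T L (\<lambda>t l. f t l + g t l)"
proof (induction k arbitrary: f g)
  case (Suc k)
  obtain f' g' where "param_smooth k T L f'" "has_param_deriv T L f f'"
    "param_smooth k T L g'" "has_param_deriv T L g g'"
    using Suc.prems by auto
  then show ?case
    by (intro param_smooth_SucI[where g = "\<lambda>t l. f' t l + g' t l"] has_param_deriv_add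
        continuous_on_param_add_mult Suc.IH Suc.prems[THEN param_smooth_continuous])
qed (simp add: continuous_on_param_add_mult)

lemma param_smooth_mult:
  "param_smooth k T L f \<Longrightarrow> param_smooth k T L g \<Longrightarrow> param_smooth k T L (\<lambda>t l. f t l * g t l)"
proof (induction k arbitrary: f g)
  case (Suc k)
  obtain f' g' where fg: "param_smooth k T L f'" "has_param_deriv T L f f'"
    "param_smooth k T L g'" "has_param_deriv T L g g'"
    using Suc.prems by auto
  \<comment> \<open>Each summand pairs a derivative of order \<open>k\<close> with an original
    factor of order \<open>Suc k\<close>; the latter is lowered by one so that the induction
    hypothesis fits both.\<close>
  then have "param_smooth k T L (\<lambda>t l. f' t l * g t l + f t l * g' t l)"
    using Suc.IH Suc.prems[THEN param_smooth_Suc_imp] by (simp add: param_smooth_add)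
  then show ?case
    by (rule param_smooth_SucI[OF continuous_on_param_add_mult(2)[OF
            Suc.prems[THEN param_smooth_continuous]] _ has_param_deriv_mult[OF fg(2,4)]])
qed (simp add: continuous_on_param_add_mult)

lemma param_smooth_const: "param_smooth k T L (\<lambda>t l. c)"
proof (induction k arbitrary: c)
  case (Suc k)
  have "has_param_deriv T L (\<lambda>t l. c) (\<lambda>t l. 0)"
    by (simp add: has_param_deriv_def)
  then show ?case
    using Suc by (auto simp: split_beta)
qed (simp add: split_beta)

lemma param_smooth_minus: "param_smooth k T L f \<Longrightarrow> param_smooth k T L (\<lambda>t l. - f t l)"
  using param_smooth_mult[OF param_smooth_const[of k T L "-1"]] by simp

lemma param_smooth_diff:
  "param_smooth k T L f \<Longrightarrow> param_smooth k T L g \<Longrightarrow> param_smooth k T L (\<lambda>t l. f t l - g t l)"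
  using param_smooth_add[OF _ param_smooth_minus] by fastforce

section \<open>Integrals over a variable time interval\<close>

text \<open>Rescaling to a fixed interval moves \<open>t\<close> from the limit of integration into
  the integrand, so that continuity in \<open>t\<close> becomes continuity of an integral in a
  parameter.\<close>

lemma integral_eq_unit_integral:
  fixes f :: "real \<Rightarrow> real"
  assumes "0 \<le> t"
  shows "integral {0..t} f = t * integral {0..1} (\<lambda>u. f (t * u))"
proof (cases "t = 0")
  case False
  then have t: "t > 0" using assms by simp
  have "(\<lambda>x. x / t) ` {0..t} = {0..1}"
    using t image_affinity_atLeastAtMost_div[of t 0 0 t] by simp
  then show ?thesis
    using integral_stretch_real[of t 0 t f] t by simp
qed simp

lemma continuous_on_integral_param:
  fixes f :: "real \<Rightarrow> real \<Rightarrow> real"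
  assumes "continuous_on ({0..T} \<times> {0..L}) (\<lambda>(t, l). f t l)"
  shows "continuous_on ({0..T} \<times> {0..L}) (\<lambda>(t, l). integral {0..t} (\<lambda>s. f s l))"
proof -
  have sub: "t * u \<in> {0..T}" if "t \<in> {0..T}" "u \<in> {0..1}" for t u
    using that mult_left_le[of u t] by auto
  have "continuous_on (({0..T} \<times> {0..L}) \<times> cbox 0 1) (\<lambda>(p, u). f (fst p * u) (snd p))"
    using continuous_on_compose2[OF assms, where f = "\<lambda>p. (fst (fst p) * snd p, snd (fst p))"
        and s = "({0..T} \<times> {0..L}) \<times> cbox 0 1"] sub
    by (simp add: split_beta image_subset_iff continuous_on_Pair continuous_on_mult
        continuous_on_fst continuous_on_snd continuous_on_id)
  from integral_continuous_on_param[OF this]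
  have "continuous_on ({0..T} \<times> {0..L}) (\<lambda>p. fst p * integral {0..1} (\<lambda>u. f (fst p * u) (snd p)))"
    by (auto intro!: continuous_intros)
  then show ?thesis
    by (rule continuous_on_eq)
      (auto intro: integral_eq_unit_integral[symmetric])
qed

lemma continuous_on_slice:
  fixes f :: "real \<Rightarrow> real \<Rightarrow> real"
  assumes "continuous_on ({0..T} \<times> {0..L}) (\<lambda>(t, l). f t l)" and "l \<in> {0..L}" and "t \<le> T"
  shows "continuous_on {0..t} (\<lambda>s. f s l)"
proof -
  have "continuous_on {0..t} (\<lambda>s. case (s, l) of (t, l) \<Rightarrow> f t l)"
    by (rule continuous_on_compose2[OF assms(1)]) (use assms(2,3) in \<open>auto intro!: continuous_intros\<close>)
  then show ?thesis
    by simp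
qed

lemma has_param_deriv_integral:
  fixes f g :: "real \<Rightarrow> real \<Rightarrow> real"
  assumes f: "continuous_on ({0..T} \<times> {0..L}) (\<lambda>(t, l). f t l)"
    and g: "continuous_on ({0..T} \<times> {0..L}) (\<lambda>(t, l). g t l)"
    and deriv: "has_param_deriv T L f g"
  shows "has_param_deriv T L (\<lambda>t l. integral {0..t} (\<lambda>s. f s l)) (\<lambda>t l. integral {0..t} (\<lambda>s. g s l))"
  unfolding has_param_deriv_def
proof (intro ballI)
  fix t l assume t: "t \<in> {0..T}" and l: "l \<in> {0..L}"
  have "continuous_on ({0..L} \<times> cbox 0 t) (\<lambda>p. case (snd p, fst p) of (t, l) \<Rightarrow> g t l)"
    by (rule continuous_on_compose2[OF g]) (use t in \<open>auto intro!: continuous_intros\<close>)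
  then have cont: "continuous_on ({0..L} \<times> cbox 0 t) (\<lambda>(l, s). g s l)"
    by (simp add: split_beta)
  have "((\<lambda>l. integral (cbox 0 t) (\<lambda>s. f s l)) has_real_derivative integral (cbox 0 t) (\<lambda>s. g s l))
          (at l within {0..L})"
  proof (rule leibniz_rule_field_derivative[OF _ _ cont l])
    show "((\<lambda>l. f s l) has_real_derivative g s l) (at l within {0..L})"
      if "l \<in> {0..L}" "s \<in> cbox 0 t" for l s
      using has_param_derivD[OF deriv] that t by simp
    show "(\<lambda>s. f s l) integrable_on cbox 0 t" if "l \<in> {0..L}" for l
      using integrable_continuous_real[OF continuous_on_slice[OF f that, of t]] t by simp
  qed simp
  then show "((\<lambda>l. integral {0..t} (\<lambda>s. f s l)) has_real_derivative integral {0..t} (\<lambda>s. g s l))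
          (at l within {0..L})"
    by simp
qed

lemma param_smooth_integral:
  "param_smooth k T L f \<Longrightarrow> param_smooth k T L (\<lambda>t l. integral {0..t} (\<lambda>s. f s l))"
proof (induction k arbitrary: f)
  case 0
  then show ?case using continuous_on_integral_param by simp
next
  case (Suc k)
  obtain f' where f': "param_smooth k T L f'" "has_param_deriv T L f f'"
    using Suc.prems by auto
  show ?case
    using has_param_deriv_integral[OF Suc.prems[THEN param_smooth_continuous]
        f'(1)[THEN param_smooth_continuous] f'(2)]
    by (rule param_smooth_SucI[OF continuous_on_integral_param[OF
            Suc.prems[THEN param_smooth_continuous]] Suc.IH[OF f'(1)]])
qed

text \<open>The chain rule along the slice \<open>l \<mapsto> (t, l)\<close> kills the term with
  \<open>q1\<close>, so the second partial derivative, again of class \<open>C_k_on k\<close>,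
  serves as parameter derivative.\<close>

lemma C_k_on_imp_param_smooth:
  fixes T L :: real
  shows "C_k_on k (UNIV \<times> {0..L}) q \<Longrightarrow> param_smooth k T L (\<lambda>t l. q (t, l))"
proof (induction k arbitrary: q)
  case 0
  then show ?case
    by (auto simp: split_beta intro: continuous_on_subset)
next
  case (Suc k)
  then obtain q1 q2 where q2: "C_k_on k (UNIV \<times> {0..L}) q2"
    and D: "\<And>p. p \<in> UNIV \<times> {0..L} \<Longrightarrow>
      (q has_derivative (\<lambda>v. q1 p * fst v + q2 p * snd v)) (at p within UNIV \<times> {0..L})"
    by (fastforce simp only: C_k_on.simps)
  have "has_param_deriv T L (\<lambda>t l. q (t, l)) (\<lambda>t l. q2 (t, l))"
    unfolding has_param_deriv_def
  proof (intro ballI)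
    fix t l :: real assume "l \<in> {0..L}"
    have "((\<lambda>l. (t, l)) has_derivative (\<lambda>h. (0, h))) (at l within {0..L})"
      by (auto intro!: derivative_eq_intros)
    from has_derivative_in_compose2[of "UNIV \<times> {0..L}", OF D _ _ this] \<open>l \<in> {0..L}\<close>
    have "((\<lambda>l. q (t, l)) has_derivative (\<lambda>h. q1 (t, l) * fst (0::real, h) + q2 (t, l) * snd (0::real, h)))
            (at l within {0..L})"
      by (simp add: image_subset_iff)
    then show "((\<lambda>l. q (t, l)) has_real_derivative q2 (t, l)) (at l within {0..L})"
      by (simp add: has_field_derivative_def)
  qed
  moreover have "continuous_on ({0..T} \<times> {0..L}) (\<lambda>(t, l). q (t, l))"
  proof -
    have "continuous_on (UNIV \<times> {0..L}) q"
      using D by (rule has_derivative_continuous_on)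
    then show ?thesis
      by (simp add: split_beta) (erule continuous_on_subset, blast)
  qed
  ultimately show ?case
    using Suc.IH[OF q2] by (intro param_smooth_SucI)
qed

section \<open>A priori bounds and Wronskian identities for Hill's equation\<close>

lemma bounded_on_rectangle:
  fixes f :: "real \<Rightarrow> real \<Rightarrow> real"
  assumes "continuous_on ({0..T} \<times> {0..L}) (\<lambda>(t, l). f t l)"
  obtains B where "B \<ge> 0" and "\<And>t l. t \<in> {0..T} \<Longrightarrow> l \<in> {0..L} \<Longrightarrow> \<bar>f t l\<bar> \<le> B"
proof -
  have "compact ((\<lambda>(t, l). f t l) ` ({0..T} \<times> {0..L}))"
    by (intro compact_continuous_image assms compact_Times compact_Icc)
  then obtain B where "B > 0" "\<forall>y\<in>(\<lambda>(t, l). f t l) ` ({0..T} \<times> {0..L}). norm y \<le> B"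
    using bounded_pos compact_imp_bounded by blast
  then show ?thesis
    using that[of B] by fastforce
qed

text \<open>Gronwall's argument for the energy \<open>x\<^sup>2 + y\<^sup>2\<close>: its derivative
  is \<open>2 x y (1 - Q)\<close>, which is at most \<open>1 + M\<close> times the energy because
  \<open>\<bar>2 x y\<bar> \<le> x\<^sup>2 + y\<^sup>2\<close>. Hence the energy damped by
  \<open>exp (- (1 + M) s)\<close> is nonincreasing.\<close>

lemma hill_energy_bound:
  fixes x y Q :: "real \<Rightarrow> real"
  assumes x: "\<And>s. (x has_real_derivative y s) (at s)"
    and y: "\<And>s. (y has_real_derivative - Q s * x s) (at s)"
    and Q: "\<And>s. s \<in> {0..t} \<Longrightarrow> \<bar>Q s\<bar> \<le> M" and "0 \<le> t"
  shows "(x t)\<^sup>2 + (y t)\<^sup>2 \<le> ((x 0)\<^sup>2 + (y 0)\<^sup>2) * exp ((1 + M) * t)"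
proof -
  define c where "c = 1 + M"
  define F where "F = (\<lambda>s. ((x s)\<^sup>2 + (y s)\<^sup>2) * exp (- (c * s)))"
  define F' where "F' = (\<lambda>s. (2 * (x s * y s) * (1 - Q s) - c * ((x s)\<^sup>2 + (y s)\<^sup>2)) * exp (- (c * s)))"
  have F: "(F has_real_derivative F' s) (at s)" for s
    unfolding F_def F'_def
    by (auto intro!: derivative_eq_intros x y simp: algebra_simps power2_eq_square)
  have F': "F' s \<le> 0" if "s \<in> {0..t}" for s
  proof -
    have "2 * (x s * y s) * (1 - Q s) \<le> \<bar>2 * (x s * y s)\<bar> * \<bar>1 - Q s\<bar>"
      by (metis abs_ge_self abs_mult)
    also have "\<dots> \<le> ((x s)\<^sup>2 + (y s)\<^sup>2) * c"
    proof (rule mult_mono)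
      show "\<bar>2 * (x s * y s)\<bar> \<le> (x s)\<^sup>2 + (y s)\<^sup>2"
        using sum_squares_bound[of "\<bar>x s\<bar>" "\<bar>y s\<bar>"] by (simp add: abs_mult)
    qed (use Q[OF that] in \<open>auto simp: c_def\<close>)
    finally show ?thesis
      by (simp add: F'_def mult_le_0_iff mult.commute)
  qed
  have "F t \<le> F 0"
    by (rule DERIV_nonpos_imp_nonincreasing[OF \<open>0 \<le> t\<close>]) (use F F' in auto)
  then have "((x t)\<^sup>2 + (y t)\<^sup>2) / exp (c * t) \<le> (x 0)\<^sup>2 + (y 0)\<^sup>2"
    by (simp add: F_def exp_minus divide_inverse)
  then show ?thesis
    by (simp add: pos_divide_le_eq flip: c_def)
qed

text \<open>The velocity \<open>v\<close> is a function in its own right because the discriminant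
  contains the velocity of the second solution. Initial data shared by all parameters make the
  boundary term at time 0 constant when two parameters are compared.\<close>

definition hill_flow ::
    "real \<Rightarrow> (real \<Rightarrow> real \<Rightarrow> real) \<Rightarrow> real \<Rightarrow> real \<Rightarrow> (real \<Rightarrow> real \<Rightarrow> real) \<Rightarrow> (real \<Rightarrow> real \<Rightarrow> real) \<Rightarrow> bool"
  where
  "hill_flow L q a b u v \<longleftrightarrow>
     (\<forall>l\<in>{0..L}. u 0 l = a \<and> v 0 l = b \<and>
        (\<forall>t. ((\<lambda>t. u t l) has_real_derivative v t l) (at t) \<and>
             ((\<lambda>t. v t l) has_real_derivative - q t l * u t l) (at t)))"

lemma hill_flowD:
  assumes "hill_flow L q a b u v" and "l \<in> {0..L}"
  shows "u 0 l = a" and "v 0 l = b"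
    and "((\<lambda>t. u t l) has_real_derivative v t l) (at t)"
    and "((\<lambda>t. v t l) has_real_derivative - q t l * u t l) (at t)"
  using assms by (auto simp: hill_flow_def)

lemma hill_flow_continuous:
  assumes "hill_flow L q a b u v" and "l \<in> {0..L}"
  shows "continuous_on S (\<lambda>t. u t l)" and "continuous_on S (\<lambda>t. v t l)"
  by (intro continuous_at_imp_continuous_on ballI DERIV_isCont[OF hill_flowD(3)[OF assms]]
      DERIV_isCont[OF hill_flowD(4)[OF assms]])+

lemma hill_flow_bounded:
  assumes flow: "hill_flow L q a b u v"
    and q: "continuous_on ({0..T} \<times> {0..L}) (\<lambda>(t, l). q t l)"
  obtains B where "B \<ge> 0"
    and "\<And>t l. t \<in> {0..T} \<Longrightarrow> l \<in> {0..L} \<Longrightarrow> \<bar>u t l\<bar> \<le> B \<and> \<bar>v t l\<bar> \<le> B"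
proof -
  obtain M where M: "M \<ge> 0" "\<And>t l. t \<in> {0..T} \<Longrightarrow> l \<in> {0..L} \<Longrightarrow> \<bar>q t l\<bar> \<le> M"
    using bounded_on_rectangle[OF q] by blast
  define E where "E = (a\<^sup>2 + b\<^sup>2) * exp ((1 + M) * T)"
  have "\<bar>u t l\<bar> \<le> sqrt E \<and> \<bar>v t l\<bar> \<le> sqrt E" if t: "t \<in> {0..T}" and l: "l \<in> {0..L}" for t l
  proof -
    have "(u t l)\<^sup>2 + (v t l)\<^sup>2 \<le> ((u 0 l)\<^sup>2 + (v 0 l)\<^sup>2) * exp ((1 + M) * t)"
      by (rule hill_energy_bound[where Q = "\<lambda>t. q t l"])
        (use hill_flowD[OF flow l] M(2) t l in auto)
    also have "\<dots> \<le> E"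
      using t M(1) hill_flowD(1,2)[OF flow l] by (auto simp: E_def intro!: mult_left_mono)
    finally have "(u t l)\<^sup>2 \<le> E" "(v t l)\<^sup>2 \<le> E"
      using zero_le_power2[of "u t l"] zero_le_power2[of "v t l"] by linarith+
    then show ?thesis
      by (simp add: real_le_rsqrt)
  qed
  moreover have "sqrt E \<ge> 0"
    by (simp add: E_def)
  ultimately show ?thesis
    using that by blast
qed

text \<open>The Wronskian of solutions at two different parameters is not conserved: its derivative
  is exactly this integrand, since the \<open>v \<psi>\<close> terms cancel. For
  \<open>l = m\<close> the integral vanishes and the classical conservation law is
  recovered.\<close>

lemma hill_flow_cross_integral:
  assumes uv: "hill_flow L q a b u v" and \<phi>: "hill_flow L q c d \<phi> \<psi>"
    and l: "l \<in> {0..L}" and m: "m \<in> {0..L}" and t: "0 \<le> t"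
  shows "integral {0..t} (\<lambda>s. (q s l - q s m) * u s m * \<phi> s l)
           = v t m * \<phi> t l - u t m * \<psi> t l - (b * c - a * d)"
proof -
  have "((\<lambda>t. v t m * \<phi> t l - u t m * \<psi> t l) has_real_derivative (q s l - q s m) * u s m * \<phi> s l) (at s)" for s
    by (auto intro!: derivative_eq_intros hill_flowD[OF uv m] hill_flowD[OF \<phi> l] simp: algebra_simps)
  then have "((\<lambda>s. (q s l - q s m) * u s m * \<phi> s l) has_integral
      (v t m * \<phi> t l - u t m * \<psi> t l - (v 0 m * \<phi> 0 l - u 0 m * \<psi> 0 l))) {0..t}"
    by (intro fundamental_theorem_of_calculus t)
      (auto simp: has_real_derivative_iff_has_vector_derivative intro: has_vector_derivative_at_within)
  then show ?thesis
    by (simp add: integral_unique hill_flowD[OF uv m] hill_flowD[OF \<phi> l])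
qed

text \<open>The difference quotient is at most \<open>\<bar>C\<bar> \<bar>m - l\<bar>\<close>, which
  tends to 0.\<close>

lemma has_real_derivative_quadratic_bound:
  fixes R :: "real \<Rightarrow> real"
  assumes "R l = 0" and "\<And>m. m \<in> S \<Longrightarrow> \<bar>R m\<bar> \<le> C * (m - l)\<^sup>2"
  shows "(R has_real_derivative 0) (at l within S)"
proof -
  have "((\<lambda>m. C * (m - l)) \<longlongrightarrow> C * (l - l)) (at l within S)"
    by (intro tendsto_intros)
  then have *: "((\<lambda>m. C * (m - l)) \<longlongrightarrow> 0) (at l within S)"
    by simp
  have "\<forall>\<^sub>F m in at l within S. norm ((R m - R l) / (m - l)) \<le> norm (C * (m - l))"
    unfolding eventually_at_filter
  proof (intro always_eventually allI impI)
    fix m assume "m \<noteq> l" "m \<in> S"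
    have "\<bar>R m\<bar> \<le> \<bar>C\<bar> * (m - l)\<^sup>2"
      using assms(2)[OF \<open>m \<in> S\<close>] mult_right_mono[OF abs_ge_self[of C] zero_le_power2[of "m - l"]]
      by linarith
    also have "\<dots> = \<bar>C\<bar> * \<bar>m - l\<bar> * \<bar>m - l\<bar>"
      by (simp add: power2_eq_square mult.assoc)
    finally show "norm ((R m - R l) / (m - l)) \<le> norm (C * (m - l))"
      using \<open>m \<noteq> l\<close> assms(1) by (simp add: abs_mult pos_divide_le_eq)
  qed
  then show ?thesis
    unfolding has_field_derivative_iff by (rule Lim_null_comparison) (use * tendsto_norm_zero in blast)
qed

text \<open>Separate continuity becomes joint continuity because the Lipschitz constant is uniform
  in \<open>t\<close>.\<close>

lemma continuous_on_Lipschitz_param: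
  fixes f :: "real \<Rightarrow> real \<Rightarrow> real"
  assumes "\<And>l. l \<in> Y \<Longrightarrow> continuous_on X (\<lambda>t. f t l)" and "C \<ge> 0"
    and "\<And>t l m. t \<in> X \<Longrightarrow> l \<in> Y \<Longrightarrow> m \<in> Y \<Longrightarrow> \<bar>f t m - f t l\<bar> \<le> C * \<bar>m - l\<bar>"
  shows "continuous_on (X \<times> Y) (\<lambda>(t, l). f t l)"
proof -
  have "local_lipschitz X Y f"
  proof (rule local_lipschitzI)
    fix t l
    have "C-lipschitz_on (cball l 1 \<inter> Y) (f s)" if "s \<in> X" for s
      using that assms(2,3) by (intro lipschitz_onI) (auto simp: dist_real_def)
    then show "\<exists>u>0. \<exists>C. \<forall>s\<in>cball t u \<inter> X. C-lipschitz_on (cball l u \<inter> Y) (f s)"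
      by (intro exI[of _ 1] conjI exI[of _ C]) auto
  qed
  then show ?thesis
    using assms(1) by (rule continuous_on_TimesI)
qed

section \<open>Variation of constants and differentiation of solutions in the parameter\<close>

text \<open>The functions \<open>\<phi>1\<close>, \<open>\<psi>1\<close> and \<open>\<phi>2\<close>,
  \<open>\<psi>2\<close> are the columns of the fundamental matrix that is the identity at time 0,
  and \<open>q'\<close> is the parameter derivative of \<open>q\<close>. No regularity of the
  solutions in the parameter is presupposed.\<close>

locale hill_system =
  fixes T L :: real and q q' \<phi>1 \<psi>1 \<phi>2 \<psi>2 :: "real \<Rightarrow> real \<Rightarrow> real"
  assumes q: "continuous_on ({0..T} \<times> {0..L}) (\<lambda>(t, l). q t l)"
    and q': "continuous_on ({0..T} \<times> {0..L}) (\<lambda>(t, l). q' t l)"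
    and q_deriv: "has_param_deriv T L q q'"
    and flow1: "hill_flow L q 1 0 \<phi>1 \<psi>1"
    and flow2: "hill_flow L q 0 1 \<phi>2 \<psi>2"
begin

text \<open>A solution \<open>u\<close> at parameter \<open>m\<close> solves the equation at the
  base parameter \<open>l\<close> with forcing \<open>(q s l - q s m) * u s m\<close>; this is that
  forcing tested against a solution \<open>\<phi>\<close> at \<open>l\<close>.\<close>

definition duhamel :: "(real \<Rightarrow> real \<Rightarrow> real) \<Rightarrow> (real \<Rightarrow> real \<Rightarrow> real) \<Rightarrow> real \<Rightarrow> real \<Rightarrow> real \<Rightarrow> real" where
  "duhamel u \<phi> t l m = integral {0..t} (\<lambda>s. (q s l - q s m) * u s m * \<phi> s l)"

text \<open>The cross integrals of \<open>u\<close> with \<open>\<phi>1\<close> and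
  \<open>\<phi>2\<close> form a linear system for \<open>u t m\<close> and \<open>v t m\<close>
  whose determinant is, up to sign, the Wronskian at \<open>l\<close>. Solving it gives both
  formulas.\<close>

lemma variation_of_constants:
  assumes uv: "hill_flow L q a b u v" and l: "l \<in> {0..L}" and m: "m \<in> {0..L}" and t: "0 \<le> t"
  shows "u t m = u t l + \<phi>2 t l * duhamel u \<phi>1 t l m - \<phi>1 t l * duhamel u \<phi>2 t l m"
    and "v t m = v t l + \<psi>2 t l * duhamel u \<phi>1 t l m - \<psi>1 t l * duhamel u \<phi>2 t l m"
proof -
  \<comment> \<open>With both parameters equal to \<open>l\<close> the integrand vanishes, leaving
    conservation of the Wronskian.\<close>
  have wronskian: "\<psi>2 t l * \<phi>1 t l - \<phi>2 t l * \<psi>1 t l = 1"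
    using hill_flow_cross_integral[OF flow2 flow1 l l t] by simp
  have I1: "duhamel u \<phi>1 t l k = v t k * \<phi>1 t l - u t k * \<psi>1 t l - b" if "k \<in> {0..L}" for k
    using hill_flow_cross_integral[OF uv flow1 l that t] by (simp add: duhamel_def)
  have I2: "duhamel u \<phi>2 t l k = v t k * \<phi>2 t l - u t k * \<psi>2 t l + a" if "k \<in> {0..L}" for k
    using hill_flow_cross_integral[OF uv flow2 l that t] by (simp add: duhamel_def)
  have "\<phi>2 t l * duhamel u \<phi>1 t l k - \<phi>1 t l * duhamel u \<phi>2 t l k
      = u t k * (\<psi>2 t l * \<phi>1 t l - \<phi>2 t l * \<psi>1 t l) - b * \<phi>2 t l - a * \<phi>1 t l"
    and "\<psi>2 t l * duhamel u \<phi>1 t l k - \<psi>1 t l * duhamel u \<phi>2 t l k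
      = v t k * (\<psi>2 t l * \<phi>1 t l - \<phi>2 t l * \<psi>1 t l) - b * \<psi>2 t l - a * \<psi>1 t l"
    if "k \<in> {0..L}" for k
    unfolding I1[OF that] I2[OF that] by algebra+
  \<comment> \<open>The terms with \<open>a\<close> and \<open>b\<close> do not depend on
    \<open>k\<close>, so subtracting the case \<open>k = l\<close> from \<open>k = m\<close> removes
    them.\<close>
  from this[OF m] this[OF l] have
    "\<phi>2 t l * duhamel u \<phi>1 t l m - \<phi>1 t l * duhamel u \<phi>2 t l m
       - (\<phi>2 t l * duhamel u \<phi>1 t l l - \<phi>1 t l * duhamel u \<phi>2 t l l) = u t m - u t l"
    "\<psi>2 t l * duhamel u \<phi>1 t l m - \<psi>1 t l * duhamel u \<phi>2 t l m
       - (\<psi>2 t l * duhamel u \<phi>1 t l l - \<psi>1 t l * duhamel u \<phi>2 t l l) = v t m - v t l"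
    unfolding wronskian by simp_all
  moreover have "duhamel u \<phi> t l l = 0" for \<phi>
    by (simp add: duhamel_def)
  ultimately show "u t m = u t l + \<phi>2 t l * duhamel u \<phi>1 t l m - \<phi>1 t l * duhamel u \<phi>2 t l m"
    and "v t m = v t l + \<psi>2 t l * duhamel u \<phi>1 t l m - \<psi>1 t l * duhamel u \<phi>2 t l m"
    by simp_all
qed

lemma q_Lipschitz:
  obtains N where "N \<ge> 0"
    and "\<And>t l m. t \<in> {0..T} \<Longrightarrow> l \<in> {0..L} \<Longrightarrow> m \<in> {0..L} \<Longrightarrow> \<bar>q t l - q t m\<bar> \<le> N * \<bar>l - m\<bar>"
proof -
  obtain N where N: "N \<ge> 0" "\<And>t l. t \<in> {0..T} \<Longrightarrow> l \<in> {0..L} \<Longrightarrow> \<bar>q' t l\<bar> \<le> N"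
    using bounded_on_rectangle[OF q'] by blast
  have "norm (q t l - q t m) \<le> N * norm (l - m)"
    if "t \<in> {0..T}" "l \<in> {0..L}" "m \<in> {0..L}" for t l m
    by (rule field_differentiable_bound[of "{0..L}" _ "q' t"])
      (use that N has_param_derivD[OF q_deriv] in auto)
  then show ?thesis
    using that[OF N(1)] by simp
qed

lemma duhamel_integrand_continuous:
  assumes "hill_flow L q a b u v" and "hill_flow L q c d \<phi> \<psi>"
    and "l \<in> {0..L}" and "m \<in> {0..L}" and "k \<in> {0..L}" and "t \<le> T"
  shows "continuous_on {0..t} (\<lambda>s. (q s l - q s m) * u s k * \<phi> s l)"
  by (intro continuous_intros continuous_on_slice[OF q] hill_flow_continuous(1)[OF assms(1)]
      hill_flow_continuous(1)[OF assms(2)] assms)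

text \<open>The smallness comes from \<open>q s l - q s m\<close> alone; for \<open>u\<close> and
  \<open>\<phi>\<close> the energy bounds suffice.\<close>

lemma duhamel_Lipschitz:
  assumes uv: "hill_flow L q a b u v" and \<phi>: "hill_flow L q c d \<phi> \<psi>"
  obtains C where "C \<ge> 0"
    and "\<And>t l m. t \<in> {0..T} \<Longrightarrow> l \<in> {0..L} \<Longrightarrow> m \<in> {0..L} \<Longrightarrow> \<bar>duhamel u \<phi> t l m\<bar> \<le> C * \<bar>m - l\<bar>"
proof -
  obtain N where N: "N \<ge> 0" "\<And>t l m. t \<in> {0..T} \<Longrightarrow> l \<in> {0..L} \<Longrightarrow> m \<in> {0..L} \<Longrightarrow> \<bar>q t l - q t m\<bar> \<le> N * \<bar>l - m\<bar>"
    using q_Lipschitz by blast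
  obtain B where B: "B \<ge> 0" "\<And>t l. t \<in> {0..T} \<Longrightarrow> l \<in> {0..L} \<Longrightarrow> \<bar>u t l\<bar> \<le> B \<and> \<bar>v t l\<bar> \<le> B"
    using hill_flow_bounded[OF uv q] by blast
  obtain D where D: "D \<ge> 0" "\<And>t l. t \<in> {0..T} \<Longrightarrow> l \<in> {0..L} \<Longrightarrow> \<bar>\<phi> t l\<bar> \<le> D \<and> \<bar>\<psi> t l\<bar> \<le> D"
    using hill_flow_bounded[OF \<phi> q] by blast
  \<comment> \<open>The absolute value ensures \<open>C \<ge> 0\<close>, as the locale does not fix
    the sign of \<open>T\<close>.\<close>
  have "\<bar>duhamel u \<phi> t l m\<bar> \<le> \<bar>N * B * D * T\<bar> * \<bar>m - l\<bar>"
    if t: "t \<in> {0..T}" and l: "l \<in> {0..L}" and m: "m \<in> {0..L}" for t l m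
  proof -
    have "norm (duhamel u \<phi> t l m) \<le> (N * \<bar>l - m\<bar> * B * D) * (t - 0)"
      unfolding duhamel_def
    proof (rule integral_bound)
      fix s assume "s \<in> {0..t}"
      then have s: "s \<in> {0..T}"
        using t by simp
      show "norm ((q s l - q s m) * u s m * \<phi> s l) \<le> N * \<bar>l - m\<bar> * B * D"
        unfolding real_norm_def abs_mult
        by (intro mult_mono N B D mult_nonneg_nonneg abs_ge_zero l m s
            B(2)[THEN conjunct1] D(2)[THEN conjunct1])
    qed (use t duhamel_integrand_continuous[OF uv \<phi> l m m] in auto)
    also have "\<dots> \<le> (N * \<bar>l - m\<bar> * B * D) * T"
      using t N(1) B(1) D(1) by (intro mult_left_mono) auto
    also have "\<dots> = N * B * D * T * \<bar>m - l\<bar>"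
      by (simp add: abs_minus_commute)
    also have "\<dots> \<le> \<bar>N * B * D * T\<bar> * \<bar>m - l\<bar>"
      by (intro mult_right_mono) auto
    finally show ?thesis
      by simp
  qed
  then show ?thesis
    using that[of "\<bar>N * B * D * T\<bar>"] by simp
qed

lemma hill_flow_Lipschitz:
  assumes uv: "hill_flow L q a b u v"
  obtains C where "C \<ge> 0"
    and "\<And>t l m. t \<in> {0..T} \<Longrightarrow> l \<in> {0..L} \<Longrightarrow> m \<in> {0..L} \<Longrightarrow>
           \<bar>u t m - u t l\<bar> \<le> C * \<bar>m - l\<bar> \<and> \<bar>v t m - v t l\<bar> \<le> C * \<bar>m - l\<bar>"
proof -
  obtain C1 where C1: "C1 \<ge> 0" "\<And>t l m. t \<in> {0..T} \<Longrightarrow> l \<in> {0..L} \<Longrightarrow> m \<in> {0..L} \<Longrightarrow> \<bar>duhamel u \<phi>1 t l m\<bar> \<le> C1 * \<bar>m - l\<bar>"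
    using duhamel_Lipschitz[OF uv flow1] by blast
  obtain C2 where C2: "C2 \<ge> 0" "\<And>t l m. t \<in> {0..T} \<Longrightarrow> l \<in> {0..L} \<Longrightarrow> m \<in> {0..L} \<Longrightarrow> \<bar>duhamel u \<phi>2 t l m\<bar> \<le> C2 * \<bar>m - l\<bar>"
    using duhamel_Lipschitz[OF uv flow2] by blast
  obtain B1 where B1: "B1 \<ge> 0" "\<And>t l. t \<in> {0..T} \<Longrightarrow> l \<in> {0..L} \<Longrightarrow> \<bar>\<phi>1 t l\<bar> \<le> B1 \<and> \<bar>\<psi>1 t l\<bar> \<le> B1"
    using hill_flow_bounded[OF flow1 q] by blast
  obtain B2 where B2: "B2 \<ge> 0" "\<And>t l. t \<in> {0..T} \<Longrightarrow> l \<in> {0..L} \<Longrightarrow> \<bar>\<phi>2 t l\<bar> \<le> B2 \<and> \<bar>\<psi>2 t l\<bar> \<le> B2"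
    using hill_flow_bounded[OF flow2 q] by blast
  \<comment> \<open>Stated for arbitrary numbers \<open>x1\<close>, \<open>x2\<close> so that it
    serves \<open>u\<close> with the \<open>\<phi>\<close> coefficients and \<open>v\<close> with
    the \<open>\<psi>\<close> coefficients.\<close>
  have bound: "\<bar>x2 * duhamel u \<phi>1 t l m - x1 * duhamel u \<phi>2 t l m\<bar> \<le> (B2 * C1 + B1 * C2) * \<bar>m - l\<bar>"
    if "t \<in> {0..T}" "l \<in> {0..L}" "m \<in> {0..L}" and "\<bar>x1\<bar> \<le> B1" and "\<bar>x2\<bar> \<le> B2" for t l m x1 x2
  proof -
    have "\<bar>x2 * duhamel u \<phi>1 t l m\<bar> \<le> B2 * (C1 * \<bar>m - l\<bar>)" "\<bar>x1 * duhamel u \<phi>2 t l m\<bar> \<le> B1 * (C2 * \<bar>m - l\<bar>)"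
      unfolding abs_mult using that B1(1) B2(1) C1 C2 by (auto intro!: mult_mono)
    then show ?thesis
      by (simp add: algebra_simps)
  qed
  have "\<bar>u t m - u t l\<bar> \<le> (B2 * C1 + B1 * C2) * \<bar>m - l\<bar> \<and>
        \<bar>v t m - v t l\<bar> \<le> (B2 * C1 + B1 * C2) * \<bar>m - l\<bar>"
    if "t \<in> {0..T}" "l \<in> {0..L}" "m \<in> {0..L}" for t l m
  proof -
    have "u t m - u t l = \<phi>2 t l * duhamel u \<phi>1 t l m - \<phi>1 t l * duhamel u \<phi>2 t l m"
      "v t m - v t l = \<psi>2 t l * duhamel u \<phi>1 t l m - \<psi>1 t l * duhamel u \<phi>2 t l m"
      using variation_of_constants[OF uv that(2,3), of t] that(1) by auto
    then show ?thesis
      using bound[OF that] B1(2)[OF that(1,2)] B2(2)[OF that(1,2)] by presburger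
  qed
  then show ?thesis
    using that[of "B2 * C1 + B1 * C2"] B1(1) B2(1) C1(1) C2(1) by simp
qed

lemma hill_flow_jointly_continuous:
  assumes uv: "hill_flow L q a b u v"
  shows "continuous_on ({0..T} \<times> {0..L}) (\<lambda>(t, l). u t l)"
    and "continuous_on ({0..T} \<times> {0..L}) (\<lambda>(t, l). v t l)"
proof -
  obtain C where C: "C \<ge> 0"
    "\<And>t l m. t \<in> {0..T} \<Longrightarrow> l \<in> {0..L} \<Longrightarrow> m \<in> {0..L} \<Longrightarrow>
           \<bar>u t m - u t l\<bar> \<le> C * \<bar>m - l\<bar> \<and> \<bar>v t m - v t l\<bar> \<le> C * \<bar>m - l\<bar>"
    using hill_flow_Lipschitz[OF uv] by blast
  show "continuous_on ({0..T} \<times> {0..L}) (\<lambda>(t, l). u t l)"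
    and "continuous_on ({0..T} \<times> {0..L}) (\<lambda>(t, l). v t l)"
    using C by (auto intro!: continuous_on_Lipschitz_param[of _ _ _ C] hill_flow_continuous[OF uv])
qed

lemma duhamel_deriv:
  assumes uv: "hill_flow L q a b u v" and \<phi>: "hill_flow L q c d \<phi> \<psi>"
    and t: "t \<in> {0..T}" and l: "l \<in> {0..L}"
  shows "((\<lambda>m. duhamel u \<phi> t l m) has_real_derivative - integral {0..t} (\<lambda>s. q' s l * u s l * \<phi> s l))
           (at l within {0..L})"
proof -
  \<comment> \<open>Both \<open>q s m\<close> and \<open>u s m\<close> vary with \<open>m\<close>, but the remainder \<open>R\<close> is quadratic in \<open>m - l\<close>
    because each is Lipschitz, so \<open>u\<close> need not be known to be differentiable beforehand.\<close>
  define A where "A = (\<lambda>m. integral {0..t} (\<lambda>s. (q s l - q s m) * (u s l * \<phi> s l)))"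
  define R where "R = (\<lambda>m. integral {0..t} (\<lambda>s. (q s l - q s m) * (u s m - u s l) * \<phi> s l))"
  have split: "duhamel u \<phi> t l m = A m + R m" if m: "m \<in> {0..L}" for m
  proof -
    have "t \<le> T" using t by simp
    note cont = duhamel_integrand_continuous[OF uv \<phi> l m _ this, THEN integrable_continuous_real]
    show ?thesis
      unfolding duhamel_def A_def R_def
      using integral_add[OF cont[OF l] integrable_diff[OF cont[OF m] cont[OF l]]]
      by (simp add: algebra_simps)
  qed
  have slice: "continuous_on ({0..T} \<times> {0..L}) (\<lambda>(s, m). g s)"
    if "continuous_on {0..T} g" for g :: "real \<Rightarrow> real"
    unfolding split_beta by (rule continuous_on_compose2[OF that]) (auto intro: continuous_intros)
  have cont: "continuous_on ({0..T} \<times> {0..L}) (\<lambda>(s, m). (q s l - q s m) * (u s l * \<phi> s l))"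
    "continuous_on ({0..T} \<times> {0..L}) (\<lambda>(s, m). - q' s m * (u s l * \<phi> s l))"
    using slice[OF continuous_on_slice[OF q l order_refl]] q q'
      slice[OF hill_flow_continuous(1)[OF uv l]] slice[OF hill_flow_continuous(1)[OF \<phi> l]]
    unfolding split_beta by (auto intro!: continuous_intros)
  \<comment> \<open>In \<open>A\<close> the base parameter \<open>l\<close> is frozen inside the
    solutions and only \<open>q s m\<close> moves, so the Leibniz rule applies with \<open>m\<close>
    as parameter and is then evaluated at \<open>m = l\<close>.\<close>
  have "has_param_deriv T L (\<lambda>s m. (q s l - q s m) * (u s l * \<phi> s l)) (\<lambda>s m. - q' s m * (u s l * \<phi> s l))"
    unfolding has_param_deriv_def
    by (auto intro!: derivative_eq_intros has_param_derivD[OF q_deriv])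
  from has_param_derivD[OF has_param_deriv_integral[OF cont this] t l]
  have A: "(A has_real_derivative - integral {0..t} (\<lambda>s. q' s l * u s l * \<phi> s l)) (at l within {0..L})"
    unfolding A_def by (simp add: mult.assoc)
  obtain N where N: "N \<ge> 0" "\<And>t l m. t \<in> {0..T} \<Longrightarrow> l \<in> {0..L} \<Longrightarrow> m \<in> {0..L} \<Longrightarrow> \<bar>q t l - q t m\<bar> \<le> N * \<bar>l - m\<bar>"
    using q_Lipschitz by blast
  obtain C where C: "C \<ge> 0"
    "\<And>t l m. t \<in> {0..T} \<Longrightarrow> l \<in> {0..L} \<Longrightarrow> m \<in> {0..L} \<Longrightarrow>
           \<bar>u t m - u t l\<bar> \<le> C * \<bar>m - l\<bar> \<and> \<bar>v t m - v t l\<bar> \<le> C * \<bar>m - l\<bar>"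
    using hill_flow_Lipschitz[OF uv] by blast
  obtain D where D: "D \<ge> 0" "\<And>t l. t \<in> {0..T} \<Longrightarrow> l \<in> {0..L} \<Longrightarrow> \<bar>\<phi> t l\<bar> \<le> D \<and> \<bar>\<psi> t l\<bar> \<le> D"
    using hill_flow_bounded[OF \<phi> q] by blast
  have R: "(R has_real_derivative 0) (at l within {0..L})"
  proof (rule has_real_derivative_quadratic_bound)
    fix m assume m: "m \<in> {0..L}"
    have "norm (R m) \<le> (N * \<bar>l - m\<bar> * (C * \<bar>m - l\<bar>) * D) * (t - 0)"
      unfolding R_def
    proof (rule integral_bound)
      fix s assume "s \<in> {0..t}"
      then have s: "s \<in> {0..T}"
        using t by simp
      show "norm ((q s l - q s m) * (u s m - u s l) * \<phi> s l) \<le> N * \<bar>l - m\<bar> * (C * \<bar>m - l\<bar>) * D"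
        unfolding real_norm_def abs_mult
        by (intro mult_mono N C(1) D(1) mult_nonneg_nonneg abs_ge_zero l m s
            C(2)[THEN conjunct1] D(2)[THEN conjunct1])
    next
      show "continuous_on {0..t} (\<lambda>s. (q s l - q s m) * (u s m - u s l) * \<phi> s l)"
        using t by (intro continuous_intros continuous_on_slice[OF q] hill_flow_continuous(1)[OF uv]
            hill_flow_continuous(1)[OF \<phi>] l m) auto
    qed (use t in auto)
    also have "\<dots> = N * C * D * t * (\<bar>m - l\<bar> * \<bar>m - l\<bar>)"
      by (simp add: abs_minus_commute)
    finally show "\<bar>R m\<bar> \<le> N * C * D * t * (m - l)\<^sup>2"
      by (simp add: power2_eq_square)
  qed (simp add: R_def)
  have "((\<lambda>m. A m + R m) has_real_derivative - integral {0..t} (\<lambda>s. q' s l * u s l * \<phi> s l))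
      (at l within {0..L})"
    using DERIV_add[OF A R] by simp
  then show ?thesis
    by (rule has_field_derivative_transform_within[OF _ zero_less_one l]) (auto simp: split)
qed

text \<open>In the variation of constants formula only the \<open>duhamel\<close> terms depend on
  \<open>m\<close>; it is differentiated at \<open>m = l\<close>. The result involves just the
  solutions, \<open>q'\<close>, products and time integrals, so its regularity is inherited from
  theirs.\<close>

lemma hill_flow_param_deriv:
  assumes uv: "hill_flow L q a b u v"
  defines "W \<equiv> \<lambda>\<phi> t l. integral {0..t} (\<lambda>s. q' s l * u s l * \<phi> s l)"
  shows "has_param_deriv T L u (\<lambda>t l. \<phi>1 t l * W \<phi>2 t l - \<phi>2 t l * W \<phi>1 t l)"
    and "has_param_deriv T L v (\<lambda>t l. \<psi>1 t l * W \<phi>2 t l - \<psi>2 t l * W \<phi>1 t l)"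
proof -
  have deriv: "((\<lambda>m. c + x2 * duhamel u \<phi>1 t l m - x1 * duhamel u \<phi>2 t l m) has_real_derivative
       x1 * W \<phi>2 t l - x2 * W \<phi>1 t l) (at l within {0..L})"
    if "t \<in> {0..T}" "l \<in> {0..L}" for t l c x1 x2
    unfolding W_def
    by (auto intro!: derivative_eq_intros duhamel_deriv[OF uv flow1 that] duhamel_deriv[OF uv flow2 that])
  have "(u t has_real_derivative \<phi>1 t l * W \<phi>2 t l - \<phi>2 t l * W \<phi>1 t l) (at l within {0..L})"
    and "(v t has_real_derivative \<psi>1 t l * W \<phi>2 t l - \<psi>2 t l * W \<phi>1 t l) (at l within {0..L})"
    if t: "t \<in> {0..T}" and l: "l \<in> {0..L}" for t l
  proof -
    have "0 \<le> t" using t by simp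
    note var = variation_of_constants[OF uv l _ this, symmetric]
    show "(u t has_real_derivative \<phi>1 t l * W \<phi>2 t l - \<phi>2 t l * W \<phi>1 t l) (at l within {0..L})"
      by (rule has_field_derivative_transform_within[OF deriv[OF t l] zero_less_one l var(1)])
    show "(v t has_real_derivative \<psi>1 t l * W \<phi>2 t l - \<psi>2 t l * W \<phi>1 t l) (at l within {0..L})"
      by (rule has_field_derivative_transform_within[OF deriv[OF t l] zero_less_one l var(2)])
  qed
  then show "has_param_deriv T L u (\<lambda>t l. \<phi>1 t l * W \<phi>2 t l - \<phi>2 t l * W \<phi>1 t l)"
    "has_param_deriv T L v (\<lambda>t l. \<psi>1 t l * W \<phi>2 t l - \<psi>2 t l * W \<phi>1 t l)"
    by (simp_all add: has_param_deriv_def)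
qed

lemma param_smooth_flow_Suc:
  assumes uv: "hill_flow L q a b u v" and "param_smooth k T L q'"
    and "param_smooth k T L u"
    and "param_smooth k T L \<phi>1" "param_smooth k T L \<psi>1" "param_smooth k T L \<phi>2" "param_smooth k T L \<psi>2"
  shows "param_smooth (Suc k) T L u" and "param_smooth (Suc k) T L v"
  by (rule param_smooth_SucI[OF hill_flow_jointly_continuous(1)[OF uv] _ hill_flow_param_deriv(1)[OF uv]]
      param_smooth_SucI[OF hill_flow_jointly_continuous(2)[OF uv] _ hill_flow_param_deriv(2)[OF uv]];
      intro param_smooth_diff param_smooth_mult param_smooth_integral assms)+

text \<open>Bootstrap: the derivative of each component involves others, so all four gain an order
  together. Joint continuity starts the induction.\<close>

lemma param_smooth_fundamental_system:
  "param_smooth k T L q' \<Longrightarrow> param_smooth (Suc k) T L \<phi>1 \<and> param_smooth (Suc k) T L \<psi>1 \<and>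
     param_smooth (Suc k) T L \<phi>2 \<and> param_smooth (Suc k) T L \<psi>2"
proof (induction k)
  case 0
  have "param_smooth 0 T L \<phi>1" "param_smooth 0 T L \<psi>1" "param_smooth 0 T L \<phi>2" "param_smooth 0 T L \<psi>2"
    by (simp_all add: hill_flow_jointly_continuous[OF flow1] hill_flow_jointly_continuous[OF flow2])
  then show ?case
    using param_smooth_flow_Suc[OF flow1 0] param_smooth_flow_Suc[OF flow2 0] by blast
next
  case (Suc k)
  note IH = Suc.IH[OF param_smooth_Suc_imp[OF Suc.prems]]
  show ?case
    using param_smooth_flow_Suc[OF flow1 Suc.prems] param_smooth_flow_Suc[OF flow2 Suc.prems] IH
    by blast
qed

end

section \<open>Smoothness of the discriminant\<close>

lemma hill_solutionD:
  assumes "hill_solution Q x"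
  shows "(x has_real_derivative deriv x t) (at t)"
    and "(deriv x has_real_derivative - Q t * x t) (at t)"
proof -
  have "x differentiable (at t)" and d: "deriv x differentiable (at t)"
    and "deriv (deriv x) t = - Q t * x t"
    using assms by (auto simp: hill_solution_def eq_neg_iff_add_eq_0)
  then show "(x has_real_derivative deriv x t) (at t)"
    and "(deriv x has_real_derivative - Q t * x t) (at t)"
    by (metis DERIV_imp_deriv real_differentiable_def)+
qed

text \<open>\<open>is_discriminant\<close> supplies solutions for each parameter separately, with no
  link between parameters. Any selection of them forms a \<open>hill_system\<close>, which provides
  the regularity in \<open>l\<close>. \<open>D\<close> keeps a time argument to stay within
  \<open>param_smooth\<close>; its value at time \<open>T\<close> is the discriminant.\<close>

lemma discriminant_smooth:
  fixes T L :: real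
  assumes q: "C_k_on (Suc k) (UNIV \<times> {0..L}) q"
    and disc: "\<And>l. l \<in> {0..L} \<Longrightarrow> is_discriminant T (\<lambda>t. q (t, l)) (\<Delta> l)"
  obtains D where "param_smooth (Suc k) T L D" and "\<And>l. l \<in> {0..L} \<Longrightarrow> D T l = \<Delta> l"
proof -
  \<comment> \<open>Pairing the two solutions lets a single choice function select both.\<close>
  have "\<forall>l\<in>{0..L}. \<exists>x. hill_solution (\<lambda>t. q (t, l)) (fst x) \<and> fst x 0 = 1 \<and> deriv (fst x) 0 = 0 \<and>
      hill_solution (\<lambda>t. q (t, l)) (snd x) \<and> snd x 0 = 0 \<and> deriv (snd x) 0 = 1 \<and>
      \<Delta> l = fst x T + deriv (snd x) T"
    using disc unfolding is_discriminant_def by simp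
  then obtain X where X: "\<And>l. l \<in> {0..L} \<Longrightarrow> hill_solution (\<lambda>t. q (t, l)) (fst (X l)) \<and>
      fst (X l) 0 = 1 \<and> deriv (fst (X l)) 0 = 0 \<and>
      hill_solution (\<lambda>t. q (t, l)) (snd (X l)) \<and> snd (X l) 0 = 0 \<and> deriv (snd (X l)) 0 = 1 \<and>
      \<Delta> l = fst (X l) T + deriv (snd (X l)) T"
    unfolding bchoice_iff by blast
  define \<phi>1 \<psi>1 \<phi>2 \<psi>2 where "\<phi>1 = (\<lambda>t l. fst (X l) t)" and "\<psi>1 = (\<lambda>t l. deriv (fst (X l)) t)"
    and "\<phi>2 = (\<lambda>t l. snd (X l) t)" and "\<psi>2 = (\<lambda>t l. deriv (snd (X l)) t)"
  have smooth_q: "param_smooth (Suc k) T L (\<lambda>t l. q (t, l))"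
    using q by (rule C_k_on_imp_param_smooth)
  then obtain q' where smooth_q': "param_smooth k T L q'" "has_param_deriv T L (\<lambda>t l. q (t, l)) q'"
    by auto
  have sol: "hill_solution (\<lambda>t. q (t, l)) (fst (X l))" "hill_solution (\<lambda>t. q (t, l)) (snd (X l))"
    if "l \<in> {0..L}" for l
    using X[OF that] by simp_all
  interpret hill_system T L "\<lambda>t l. q (t, l)" q' \<phi>1 \<psi>1 \<phi>2 \<psi>2
  proof
    show "hill_flow L (\<lambda>t l. q (t, l)) 1 0 \<phi>1 \<psi>1" "hill_flow L (\<lambda>t l. q (t, l)) 0 1 \<phi>2 \<psi>2"
      unfolding hill_flow_def \<phi>1_def \<psi>1_def \<phi>2_def \<psi>2_def
      using X hill_solutionD[OF sol(1)] hill_solutionD[OF sol(2)] by simp_all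
  qed (use smooth_q smooth_q' param_smooth_continuous in auto)
  show ?thesis
  proof
    show "param_smooth (Suc k) T L (\<lambda>t l. \<phi>1 t l + \<psi>2 t l)"
      using param_smooth_fundamental_system[OF smooth_q'(1)] by (intro param_smooth_add) blast+
    show "\<phi>1 T l + \<psi>2 T l = \<Delta> l" if "l \<in> {0..L}" for l
      using X[OF that] by (simp add: \<phi>1_def \<psi>2_def)
  qed
qed

section \<open>Iterated derivatives and Taylor's formula on a closed interval\<close>

text \<open>\<open>vector_derivative\<close> is defined by choice; it equals the derivative
  exhibited because derivatives within a nondegenerate closed interval are unique, also at the end
  points.\<close>

lemma nth_deriv_on_Suc_eq:
  assumes "0 < L" and "\<And>l. l \<in> {0..L} \<Longrightarrow> nth_deriv_on n {0..L} f l = g l"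
    and "(g has_real_derivative g') (at l within {0..L})" and "l \<in> {0..L}"
  shows "nth_deriv_on (Suc n) {0..L} f l = g'"
proof -
  have "(nth_deriv_on n {0..L} f has_real_derivative g') (at l within {0..L})"
    using has_field_derivative_transform_within[OF assms(3) zero_less_one assms(4)] assms(2) by simp
  then show ?thesis
    using vector_derivative_within_closed_interval[OF \<open>0 < L\<close> assms(4)]
    by (simp add: has_real_derivative_iff_has_vector_derivative)
qed

text \<open>Mean value inequality with a majorant \<open>G\<close>; it replaces integrating the
  bound on \<open>f'\<close>.\<close>

lemma increment_bound:
  fixes f f' G G' :: "real \<Rightarrow> real"
  assumes f: "\<And>x. x \<in> {0..L} \<Longrightarrow> (f has_real_derivative f' x) (at x within {0..L})"
    and G: "\<And>x. (G has_real_derivative G' x) (at x)"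
    and le: "\<And>x. x \<in> {0..L} \<Longrightarrow> \<bar>f' x\<bar> \<le> G' x" and l: "l \<in> {0..L}"
  shows "\<bar>f l - f 0\<bar> \<le> G l - G 0"
proof (cases "l = 0")
  case False
  then have "0 < l" using l by simp
  then have "norm (f l - f 0) \<le> G l - G 0"
  proof (rule differentiable_bound_general)
    show "continuous_on {0..l} f"
      using DERIV_continuous_on[OF f] l by (auto intro: continuous_on_subset)
    show "continuous_on {0..l} G"
      by (intro continuous_at_imp_continuous_on ballI DERIV_isCont[OF G])
    fix x assume x: "0 < x" "x < l"
    show "(f has_vector_derivative f' x) (at x)"
      using f[of x] x l by (simp add: at_within_Icc_at has_real_derivative_iff_has_vector_derivative)
    show "(G has_vector_derivative G' x) (at x)"
      using G by (simp add: has_real_derivative_iff_has_vector_derivative)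
    show "norm (f' x) \<le> G' x"
      using le[of x] x l by simp
  qed
  then show ?thesis by simp
qed simp

text \<open>The bound on \<open>d3\<close> is integrated three times from 0, with majorants
  \<open>K x\<close>, \<open>K x\<^sup>2 / 2\<close> and \<open>K x\<^sup>3 / 6\<close>; each time
  the Taylor terms are subtracted before the increment is estimated.\<close>

lemma second_order_taylor_bound:
  fixes d0 d1 d2 d3 :: "real \<Rightarrow> real"
  assumes d0: "\<And>x. x \<in> {0..L} \<Longrightarrow> (d0 has_real_derivative d1 x) (at x within {0..L})"
    and d1: "\<And>x. x \<in> {0..L} \<Longrightarrow> (d1 has_real_derivative d2 x) (at x within {0..L})"
    and d2: "\<And>x. x \<in> {0..L} \<Longrightarrow> (d2 has_real_derivative d3 x) (at x within {0..L})"
    and d3: "\<And>x. x \<in> {0..L} \<Longrightarrow> \<bar>d3 x\<bar> \<le> K" and l: "l \<in> {0..L}"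
  shows "\<bar>d0 l - (d0 0 + d1 0 * l + d2 0 * l\<^sup>2 / 2)\<bar> \<le> K * l ^ 3 / 6"
proof -
  have 2: "\<bar>d2 x - d2 0\<bar> \<le> K * x" if "x \<in> {0..L}" for x
    using increment_bound[OF d2, of "\<lambda>x. K * x" "\<lambda>_. K"] d3 that
    by (auto intro!: derivative_eq_intros)
  have 1: "\<bar>d1 x - d2 0 * x - d1 0\<bar> \<le> K * x\<^sup>2 / 2" if "x \<in> {0..L}" for x
  proof -
    have "\<bar>(d1 x - d2 0 * x) - (d1 0 - d2 0 * 0)\<bar> \<le> K * x\<^sup>2 / 2 - K * 0\<^sup>2 / 2"
      by (rule increment_bound[where f' = "\<lambda>x. d2 x - d2 0" and G' = "\<lambda>x. K * x", OF _ _ 2 that])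
        (auto intro!: derivative_eq_intros d1)
    then show ?thesis by simp
  qed
  have "\<bar>(d0 l - d1 0 * l - d2 0 * l\<^sup>2 / 2) - (d0 0 - d1 0 * 0 - d2 0 * 0\<^sup>2 / 2)\<bar> \<le> K * l ^ 3 / 6 - K * 0 ^ 3 / 6"
    by (rule increment_bound[where f' = "\<lambda>x. d1 x - d1 0 - d2 0 * x" and G' = "\<lambda>x. K * x\<^sup>2 / 2", OF _ _ _ l])
      (use 1 in \<open>auto intro!: derivative_eq_intros d0 simp: algebra_simps power2_eq_square\<close>)
  then show ?thesis
    by (simp add: algebra_simps)
qed

section \<open>The cubic \<open>p\<close>\<close>

lemma cubic_strict_mono:
  fixes K c :: real
  assumes "K > 0" and "c < 0" and "0 \<le> x" and "x < y"
  shows "K * x ^ 3 - 3 * c * x\<^sup>2 - 24 < K * y ^ 3 - 3 * c * y\<^sup>2 - 24"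
proof -
  have "K * x ^ 3 < K * y ^ 3" "(- 3 * c) * x\<^sup>2 < (- 3 * c) * y\<^sup>2"
    using assms by (intro mult_strict_left_mono power_strict_mono; simp)+
  then show ?thesis by simp
qed

lemma cubic_unique_pos_root:
  fixes K c :: real
  assumes "K > 0" and "c < 0"
  shows "\<exists>!x. x > 0 \<and> K * x ^ 3 - 3 * c * x\<^sup>2 - 24 = 0"
proof (rule ex_ex1I)
  define h where "h = (\<lambda>x. K * x ^ 3 - 3 * c * x\<^sup>2 - 24)"
  \<comment> \<open>This point satisfies \<open>y \<ge> 1\<close> and \<open>K * y \<ge> 24\<close>,
    so the cubic term alone outweighs the constant 24, and the intermediate value theorem applies on
    \<open>{0..y}\<close>.\<close>
  define y where "y = 1 + 24 / K"
  have y: "y \<ge> 1" using assms by (simp add: y_def)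
  have "24 \<le> K * y" using assms by (simp add: y_def algebra_simps)
  also have "K * y \<le> K * y ^ 3"
    using assms power_increasing[of 1 3 y] y by simp
  finally have "h y \<ge> 0"
    using assms mult_nonneg_nonneg[of "- c" "y\<^sup>2"] by (simp add: h_def)
  moreover have "h 0 \<le> 0" "continuous_on {0..y} h"
    by (auto simp: h_def intro!: continuous_intros)
  ultimately obtain x where "0 \<le> x" "h x = 0"
    using IVT'[of h 0 0 y] y by auto
  moreover have "x \<noteq> 0"
    using \<open>h x = 0\<close> by (auto simp: h_def)
  ultimately show "\<exists>x. x > 0 \<and> K * x ^ 3 - 3 * c * x\<^sup>2 - 24 = 0"
    by (auto simp: h_def intro!: exI[of _ x])
next
  fix x y assume "x > 0 \<and> K * x ^ 3 - 3 * c * x\<^sup>2 - 24 = 0" "y > 0 \<and> K * y ^ 3 - 3 * c * y\<^sup>2 - 24 = 0"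
  then show "x = y"
    using cubic_strict_mono[OF assms, of x y] cubic_strict_mono[OF assms, of y x] by force
qed

section \<open>Instability and stability near the coexistence point
  \<open>\<lambda> = 0\<close>\<close>

theorem lemma2:
  fixes T \<Lambda> K \<mu> :: real
    and q :: "real \<times> real \<Rightarrow> real"
    and \<Delta> p :: "real \<Rightarrow> real"
  assumes "T > 0" and "\<Lambda> > 0"
    and "C_k_on 3 (UNIV \<times> {0..\<Lambda>}) q"
    and "\<And>t l. l \<in> {0..\<Lambda>} \<Longrightarrow> q (t + T, l) = q (t, l)"
    and "\<And>l. l \<in> {0..\<Lambda>} \<Longrightarrow> is_discriminant T (\<lambda>t. q (t, l)) (\<Delta> l)"
    and "\<Delta> 0 = 2"
    and "nth_deriv_on 1 {0..\<Lambda>} \<Delta> 0 = 0"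
    and "nth_deriv_on 2 {0..\<Lambda>} \<Delta> 0 \<noteq> 0"
    and "K > 0"
    and "K \<ge> (SUP l\<in>{0..\<Lambda>}. \<bar>nth_deriv_on 3 {0..\<Lambda>} \<Delta> l\<bar>)"
  defines "p \<equiv> \<lambda>l. K * l ^ 3 - 3 * nth_deriv_on 2 {0..\<Lambda>} \<Delta> 0 * l ^ 2 - 24"
    and "\<mu> \<equiv> 3 * \<bar>nth_deriv_on 2 {0..\<Lambda>} \<Delta> 0\<bar> / K"
  shows "(nth_deriv_on 2 {0..\<Lambda>} \<Delta> 0 > 0 \<longrightarrow>
           (\<forall>l\<in>{0<..<min \<mu> \<Lambda>}. \<Delta> l > 2)) \<and>
         (nth_deriv_on 2 {0..\<Lambda>} \<Delta> 0 < 0 \<longrightarrow>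
           (\<exists>!\<mu>0. \<mu>0 > 0 \<and> p \<mu>0 = 0) \<and>
           (p \<Lambda> > 0 \<longrightarrow>
              (\<forall>\<mu>0. \<mu>0 > 0 \<and> p \<mu>0 = 0 \<longrightarrow>
                 (\<forall>l\<in>{0<..<min \<mu> (min \<mu>0 \<Lambda>)}. \<bar>\<Delta> l\<bar> < 2))) \<and>
           (p \<Lambda> \<le> 0 \<longrightarrow> (\<forall>l\<in>{0<..<min \<mu> \<Lambda>}. \<bar>\<Delta> l\<bar> < 2)))"
proof -
  have nums: "(3::nat) = Suc 2" "(2::nat) = Suc 1" "(1::nat) = Suc 0"
    by simp_all
  define c where "c = nth_deriv_on 2 {0..\<Lambda>} \<Delta> 0"
  have "C_k_on (Suc 2) (UNIV \<times> {0..\<Lambda>}) q"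
    using assms(3) by (simp only: nums(1))
  then obtain D where D: "param_smooth (Suc 2) T \<Lambda> D" and D_eq: "\<And>l. l \<in> {0..\<Lambda>} \<Longrightarrow> D T l = \<Delta> l"
    using discriminant_smooth[OF _ assms(5)] by blast
  obtain D1 where D1: "param_smooth 2 T \<Lambda> D1" "has_param_deriv T \<Lambda> D D1"
    using D by (auto simp only: param_smooth.simps)
  obtain D2 where D2: "param_smooth 1 T \<Lambda> D2" "has_param_deriv T \<Lambda> D1 D2"
    using D1(1) by (auto simp only: nums(2) param_smooth.simps)
  obtain D3 where D3: "param_smooth 0 T \<Lambda> D3" "has_param_deriv T \<Lambda> D2 D3"
    using D2(1) by (auto simp only: nums(3) param_smooth.simps)
  have T: "T \<in> {0..T}" using \<open>T > 0\<close> by simp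
  note deriv = has_param_derivD[OF D1(2) T] has_param_derivD[OF D2(2) T] has_param_derivD[OF D3(2) T]
  have n1: "nth_deriv_on 1 {0..\<Lambda>} \<Delta> l = D1 T l" if "l \<in> {0..\<Lambda>}" for l
    unfolding nums(3) by (rule nth_deriv_on_Suc_eq[OF \<open>\<Lambda> > 0\<close> _ deriv(1)]) (use D_eq that in auto)
  have n2: "nth_deriv_on 2 {0..\<Lambda>} \<Delta> l = D2 T l" if "l \<in> {0..\<Lambda>}" for l
    unfolding nums(2) by (rule nth_deriv_on_Suc_eq[OF \<open>\<Lambda> > 0\<close> n1 deriv(2)]) (use that in auto)
  have n3: "nth_deriv_on 3 {0..\<Lambda>} \<Delta> l = D3 T l" if "l \<in> {0..\<Lambda>}" for l
    unfolding nums(1) by (rule nth_deriv_on_Suc_eq[OF \<open>\<Lambda> > 0\<close> n2 deriv(3)]) (use that in auto)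
  \<comment> \<open>A supremum bounds the single values only if the set is bounded above; this
    follows from continuity of \<open>D3\<close> on the compact rectangle.\<close>
  have D3_le: "\<bar>D3 T l\<bar> \<le> K" if l: "l \<in> {0..\<Lambda>}" for l
  proof -
    obtain B where "\<And>t l. t \<in> {0..T} \<Longrightarrow> l \<in> {0..\<Lambda>} \<Longrightarrow> \<bar>D3 t l\<bar> \<le> B"
      using bounded_on_rectangle[OF param_smooth_continuous[OF D3(1)]] by blast
    then have "bdd_above ((\<lambda>l. \<bar>nth_deriv_on 3 {0..\<Lambda>} \<Delta> l\<bar>) ` {0..\<Lambda>})"
      using T n3 by (intro bdd_aboveI2[of _ _ B]) simp
    from cSUP_upper[OF l this] show ?thesis
      using assms(10) n3[OF l] by simp
  qed
  have zero: "0 \<in> {0..\<Lambda>}" using \<open>\<Lambda> > 0\<close> by simp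
  have bound: "\<bar>\<Delta> l - (2 + c * l\<^sup>2 / 2)\<bar> \<le> K * l ^ 3 / 6" if l: "l \<in> {0..\<Lambda>}" for l
  proof -
    have "\<bar>D T l - (D T 0 + D1 T 0 * l + D2 T 0 * l\<^sup>2 / 2)\<bar> \<le> K * l ^ 3 / 6"
      by (rule second_order_taylor_bound[OF deriv D3_le l])
    then show ?thesis
      using D_eq[OF l] D_eq[OF zero] n1[OF zero] n2[OF zero] assms(6,7) by (simp add: c_def)
  qed
  \<comment> \<open>The remainder is smaller than the quadratic term exactly when
    \<open>K * l < 3 * \<bar>c\<bar>\<close>, which is \<open>l < \<mu>\<close>.\<close>
  have small: "K * l ^ 3 / 6 < \<bar>c\<bar> * l\<^sup>2 / 2" if "l > 0" "l < \<mu>" for l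
  proof -
    have "K * l < 3 * \<bar>c\<bar>"
      using that \<open>K > 0\<close> by (simp add: \<mu>_def c_def pos_less_divide_eq mult.commute)
    then have "K * l * l\<^sup>2 < 3 * \<bar>c\<bar> * l\<^sup>2"
      using \<open>l > 0\<close> by (intro mult_strict_right_mono) auto
    then show ?thesis
      by (simp add: power3_eq_cube power2_eq_square mult.assoc)
  qed
  have p_def': "p = (\<lambda>l. K * l ^ 3 - 3 * c * l\<^sup>2 - 24)"
    by (simp add: p_def c_def)
  have above: "\<Delta> l > 2" if "c > 0" "l \<in> {0<..<min \<mu> \<Lambda>}" for l
  proof -
    have "\<bar>\<Delta> l - (2 + c * l\<^sup>2 / 2)\<bar> \<le> K * l ^ 3 / 6" "K * l ^ 3 / 6 < c * l\<^sup>2 / 2"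
      using bound[of l] small[of l] that by auto
    then show ?thesis by linarith
  qed
  \<comment> \<open>The estimate \<open>small\<close> keeps \<Delta> below 2, and
    \<open>p l < 0\<close> keeps it above -2.\<close>
  have inside: "\<bar>\<Delta> l\<bar> < 2" if "c < 0" "l \<in> {0<..<min \<mu> \<Lambda>}" "p l < 0" for l
  proof -
    have "\<bar>\<Delta> l - (2 + c * l\<^sup>2 / 2)\<bar> \<le> K * l ^ 3 / 6" "K * l ^ 3 / 6 < - (c * l\<^sup>2 / 2)"
      "K * l ^ 3 - 3 * (c * l\<^sup>2) - 24 < 0"
      using bound[of l] small[of l] that by (auto simp: p_def')
    then show ?thesis by linarith
  qed
  \<comment> \<open>Monotonicity carries the sign of \<open>p\<close> at \<open>\<mu>0\<close> or
    \<open>\<Lambda>\<close> to every smaller \<open>l\<close>. Since \<open>l\<close> lies strictly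
    below, \<open>p \<Lambda> \<le> 0\<close> already gives \<open>p l < 0\<close>.\<close>
  have p_less: "p x < p y" if "c < 0" "0 \<le> x" "x < y" for x y
    using cubic_strict_mono[OF \<open>K > 0\<close> that] by (simp add: p_def')
  have root: "\<exists>!\<mu>0. \<mu>0 > 0 \<and> p \<mu>0 = 0" if "c < 0"
    using cubic_unique_pos_root[OF \<open>K > 0\<close> that] by (simp add: p_def')
  show ?thesis
    unfolding c_def[symmetric]
  proof (intro conjI impI allI ballI)
    fix \<mu>0 l assume c: "c < 0" and "\<mu>0 > 0 \<and> p \<mu>0 = 0" and "l \<in> {0<..<min \<mu> (min \<mu>0 \<Lambda>)}"
    then show "\<bar>\<Delta> l\<bar> < 2"
      using inside p_less[OF c, of l \<mu>0] by auto
  next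
    fix l assume c: "c < 0" and "p \<Lambda> \<le> 0" and "l \<in> {0<..<min \<mu> \<Lambda>}"
    then show "\<bar>\<Delta> l\<bar> < 2"
      using inside p_less[OF c, of l \<Lambda>] by auto
  qed (use above root in auto)
qed

end
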